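(* Let $n\in\mathbb{N}$, $a\in\mathbb{R}$, and let $f$ be an arbitrary differentiable function (for which the fractional derivatives below exist). Then \[ (\partial_x)^{a}\,[x^{(n)} f(x)] = \sum_{m=0}^{n}\sum_{u=0}^{m}\binom{n}{m}\,S_1(m,u)\,x^{(n-m)}\,(-1)^{u}(a)_{u}\,(\partial_x)^{a-u}[f(x)]. \]
   Context: $x^{(n)} = x(x+1)\cdots(x+n-1)$ is the rising factorial, $x^{(0)}=1$, with generating function $e^{-x\ln(1-t)}=\sum_{m\ge0}\frac{x^{(m)}t^m}{m!}$. $(x)_n = x(x-1)\cdots(x-n+1)$ is the falling factorial, $(x)_0=1$, and $\binom{a}{m}=(a)_m/m!$. $S_1(n,m)$ are the Stirling numbers of the first kind, defined by $(x)_n=\sum_{m=0}^n S_1(n,m)x^m$. For $a\in\mathbb{R}$, $(\partial_x)^a$ denotes fractional differentiation of order $a$ with respect to $x$: a family of linear operators which agree with the ordinary derivative of order $a$ when $a$ is a nonnegative integer and which obey the extension of the general Leibniz rule to real order: for a polynomial $p$ and a function $f$ for which the terms exist, \[ (\partial_x)^a[p(x)f(x)] = \sum_{m=0}^{\infty}\binom{a}{m}\,(\partial_x)^{a-m}[f(x)]\;p^{(m)}(x). \]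
   Formalization: The sign (-1)^u is corrected to (-1)^{m+u}; with the signed S_1 the printed formula fails for n = a = 1, f = 1, where the left side is 1 and the right side is -1. *)

theory Defs
  imports "HOL-Analysis.Analysis" "HOL-Computational_Algebra.Polynomial"
begin

text \<open>
  The rising factorial \<open>x\<^sup>(\<^sup>n\<^sup>)\<close> is \<^const>\<open>pochhammer\<close>, and \<open>binom(a, m)\<close> for real \<open>a\<close> is \<open>a gchoose m\<close>.
\<close>

definition falling_factorial :: "'a::comm_ring_1 \<Rightarrow> nat \<Rightarrow> 'a" where
  "falling_factorial x n = (\<Prod>i<n. x - of_nat i)"

text \<open>
  The signed Stirling numbers of the first kind, as the coefficients of the polynomial
  \<open>X (X - 1) \<dots> (X - n + 1)\<close>. The function \<open>stirling\<close> of HOL-Combinatorics is the unsigned version.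

  With the signed numbers one has
  \<open>(x\<^sup>(\<^sup>n\<^sup>))\<^sup>(\<^sup>u\<^sup>) = u! (\<Sum>m\<le>n. binom(n, m) (-1)\<^sup>m\<^sup>+\<^sup>u S\<^sub>1(m, u) x\<^sup>(\<^sup>n\<^sup>-\<^sup>m\<^sup>))\<close>,
  so the sign in the expansion of the fractional derivative of \<open>x\<^sup>(\<^sup>n\<^sup>) f(x)\<close> is \<open>(-1)\<^sup>m\<^sup>+\<^sup>u\<close>.
  The source prints \<open>(-1)\<^sup>u\<close>, which is a misprint: for \<open>n = a = 1\<close> it would read
  \<open>(x f)' = x f' - f\<close>.
\<close>

definition stirling_S1 :: "nat \<Rightarrow> nat \<Rightarrow> int" where
  "stirling_S1 n m = coeff (falling_factorial [:0, 1:] n) m"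

lemma falling_factorial_eq_sum_S1:
  "falling_factorial x n = (\<Sum>m\<le>n. real_of_int (stirling_S1 n m) * x ^ m)"
proof -
  define P where "P = (falling_factorial [:0, 1:] n :: int poly)"
  have lin: "[:0, 1:] - of_nat i = ([:- int i, 1:] :: int poly)" for i
    by (simp add: of_nat_poly)
  have P: "P = (\<Prod>i<n. [:- int i, 1:])"
    by (simp add: P_def falling_factorial_def lin)
  have deg: "degree P \<le> n"
    unfolding P using degree_prod_sum_le[of "{..<n}" "\<lambda>i. [:- int i, 1:]"] by simp
  have mult: "map_poly real_of_int (p * q) = map_poly real_of_int p * map_poly real_of_int q" for p q
    by (rule poly_eqI) (simp add: coeff_map_poly coeff_mult)
  have "map_poly real_of_int P = (\<Prod>i<n. [:- real i, 1:])"
    unfolding P by (induction n) (simp_all add: mult map_poly_pCons del: mult_pCons_left mult_pCons_right)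
  hence "falling_factorial x n = poly (map_poly real_of_int P) x"
    by (simp add: falling_factorial_def poly_prod)
  also have "\<dots> = (\<Sum>m\<le>n. real_of_int (coeff P m) * x ^ m)"
    unfolding poly_altdef using deg degree_map_poly[of real_of_int P]
    by (intro sum.mono_neutral_cong_left) (auto simp: coeff_map_poly coeff_eq_0)
  finally show ?thesis by (simp add: stirling_S1_def P_def)
qed

definition times_differentiable_on :: "nat \<Rightarrow> (real \<Rightarrow> real) \<Rightarrow> real set \<Rightarrow> bool" where
  "times_differentiable_on k f S \<longleftrightarrow> (\<forall>j<k. (deriv ^^ j) f differentiable_on S)"

text \<open>
  A family of fractional differentiation operators for real functions of a variable ranging over
  an open set \<open>S\<close>. The operator of order \<open>a\<close> is a partial operator: \<open>Dom a\<close> is the set of functions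
  whose derivative of order \<open>a\<close> exists, and \<open>D a f x\<close> is its value, meaningful for
  \<open>f \<in> Dom a\<close> and \<open>x \<in> S\<close>.

  In the Leibniz rule, the terms required to exist are the product on the left and those summands
  on the right whose coefficient \<open>binom(a, m) p\<^sup>(\<^sup>m\<^sup>)\<close> does not vanish; the remaining summands are
  zero. In particular, for a nonnegative integer \<open>a\<close> no derivative of negative order is involved,
  and the rule is the classical one. As \<open>p\<^sup>(\<^sup>m\<^sup>) = 0\<close> for \<open>m > degree p\<close>, the series is a finite sum.
\<close>

locale fractional_derivative =
  fixes S :: "real set"
    and Dom :: "real \<Rightarrow> (real \<Rightarrow> real) set"
    and D :: "real \<Rightarrow> (real \<Rightarrow> real) \<Rightarrow> real \<Rightarrow> real"
  assumes open_S: "open S"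
    and zero_in_Dom: "(\<lambda>x. 0) \<in> Dom a"
    and lincomb_in_Dom:
      "f \<in> Dom a \<Longrightarrow> g \<in> Dom a \<Longrightarrow> (\<lambda>x. c * f x + d * g x) \<in> Dom a"
    and linear:
      "f \<in> Dom a \<Longrightarrow> g \<in> Dom a \<Longrightarrow> x \<in> S \<Longrightarrow>
        D a (\<lambda>x. c * f x + d * g x) x = c * D a f x + d * D a g x"
    and Dom_nat: "f \<in> Dom (real k) \<longleftrightarrow> times_differentiable_on k f S"
    and D_nat: "f \<in> Dom (real k) \<Longrightarrow> x \<in> S \<Longrightarrow> D (real k) f x = (deriv ^^ k) f x"
    and leibniz:
      "(\<lambda>x. poly p x * f x) \<in> Dom a \<Longrightarrow>
        (\<And>m. m \<le> degree p \<Longrightarrow> a gchoose m \<noteq> 0 \<Longrightarrow> f \<in> Dom (a - real m)) \<Longrightarrow>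
        x \<in> S \<Longrightarrow>
        D a (\<lambda>x. poly p x * f x) x =
          (\<Sum>m. (a gchoose m) * D (a - real m) f x * poly ((pderiv ^^ m) p) x)"

end

theory Submission
  imports Defs
begin

text \<open>
  The Vandermonde identity for rising factorials, read as an identity of polynomials in the shift
  \<open>y\<close>, gives the Taylor coefficients of \<open>(x + y)\<^sup>(\<^sup>n\<^sup>)\<close> at \<open>y = 0\<close>, that is, the derivatives of the
  rising factorial; these turn the Leibniz rule into the formula.
\<close>

lemma pochhammer_eq_falling_factorial:
  "pochhammer (y::real) m = (-1) ^ m * falling_factorial (- y) m"
proof -
  have "(\<Prod>i<m. y + real i) = (\<Prod>i<m. (-1) * (- y - real i))"
    by (intro prod.cong) auto
  thus ?thesis
    by (simp only: pochhammer_prod atLeast0LessThan falling_factorial_def prod.distrib) simp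
qed

text \<open>Two signs meet here: \<open>(-1) ^ m\<close> from reflecting the \<open>m\<close>
  factors, and \<open>(-1) ^ u\<close> from the power \<open>(- y) ^ u\<close>.\<close>

lemma pochhammer_eq_sum_S1:
  "pochhammer (y::real) m = (\<Sum>u\<le>m. (-1) ^ (m + u) * real_of_int (stirling_S1 m u) * y ^ u)"
  unfolding pochhammer_eq_falling_factorial falling_factorial_eq_sum_S1 sum_distrib_left
  by (intro sum.cong) (simp_all add: power_add power_minus[of y])

lemma gbinomial_eq_falling_factorial:
  "(a::real) gchoose k = falling_factorial a k / fact k"
  by (simp add: gbinomial_prod_rev falling_factorial_def atLeast0LessThan)

lemma higher_pderiv_shift:
  fixes p :: "'a::idom poly"
  shows "(pderiv ^^ k) (pcompose p [:c, 1:]) = pcompose ((pderiv ^^ k) p) [:c, 1:]"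
  by (induction k) (simp_all add: pderiv_pcompose pderiv_pCons)

text \<open>Taylor expansion at \<open>c\<close>: shifting commutes with differentiation, so the
  value at \<open>c\<close> becomes the constant coefficient of the \<open>k\<close>-th derivative
  of the shifted polynomial.\<close>

lemma poly_higher_pderiv_eq_coeff_shift:
  fixes p :: "'a::{idom,semiring_char_0} poly"
  shows "poly ((pderiv ^^ k) p) c = fact k * coeff (pcompose p [:c, 1:]) k"
proof -
  have "poly ((pderiv ^^ k) p) c = coeff ((pderiv ^^ k) (pcompose p [:c, 1:])) 0"
    by (simp add: higher_pderiv_shift poly_pcompose flip: poly_0_coeff_0)
  also have "\<dots> = fact k * coeff (pcompose p [:c, 1:]) k"
    by (simp add: coeff_higher_pderiv pochhammer_fact)
  finally show ?thesis .
qed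

definition rising_poly :: "nat \<Rightarrow> real poly" where
  "rising_poly n = (\<Prod>i<n. [:real i, 1:])"

lemma poly_rising_poly [simp]: "poly (rising_poly n) x = pochhammer x n"
  by (simp add: rising_poly_def poly_prod pochhammer_prod atLeast0LessThan add.commute)

lemma degree_rising_poly [simp]: "degree (rising_poly n) = n"
  by (simp add: rising_poly_def degree_prod_eq_sum_degree)

text \<open>Both sides agree at every real \<open>y\<close> by Vandermonde, hence as polynomials.
  The monomial form lets the coefficient of each power be read off.\<close>

lemma rising_poly_shift:
  "pcompose (rising_poly n) [:x, 1:] =
    (\<Sum>m\<le>n. \<Sum>u\<le>m. monom (real (n choose m) * ((-1) ^ (m + u) * real_of_int (stirling_S1 m u))
       * pochhammer x (n - m)) u)"
proof -
  have "poly (pcompose (rising_poly n) [:x, 1:]) y = poly (\<Sum>m\<le>n. \<Sum>u\<le>m.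
      monom (real (n choose m) * ((-1) ^ (m + u) * real_of_int (stirling_S1 m u))
       * pochhammer x (n - m)) u) y" for y
  proof -
    have "poly (pcompose (rising_poly n) [:x, 1:]) y = pochhammer (y + x) n"
      by (simp add: poly_pcompose add.commute)
    also have "\<dots> = (\<Sum>m\<le>n. real (n choose m) * pochhammer y m * pochhammer x (n - m))"
      by (rule pochhammer_binomial_sum)
    also have "\<dots> = (\<Sum>m\<le>n. \<Sum>u\<le>m. real (n choose m)
        * ((-1) ^ (m + u) * real_of_int (stirling_S1 m u)) * pochhammer x (n - m) * y ^ u)"
      unfolding pochhammer_eq_sum_S1[of y]
      by (simp add: sum_distrib_left sum_distrib_right mult_ac)
    finally show ?thesis
      by (simp add: poly_sum poly_monom)
  qed
  thus ?thesis
    by (simp add: fun_eq_iff flip: poly_eq_poly_eq_iff)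
qed

lemma poly_higher_pderiv_rising_poly:
  "poly ((pderiv ^^ u) (rising_poly n)) x =
    fact u * (\<Sum>m\<le>n. if u \<le> m then real (n choose m)
      * ((-1) ^ (m + u) * real_of_int (stirling_S1 m u)) * pochhammer x (n - m) else 0)"
  unfolding poly_higher_pderiv_eq_coeff_shift rising_poly_shift
  by (simp add: coeff_sum)

theorem theorem4p6:
  fixes S :: "real set"
    and Dom :: "real \<Rightarrow> (real \<Rightarrow> real) set"
    and D :: "real \<Rightarrow> (real \<Rightarrow> real) \<Rightarrow> real \<Rightarrow> real"
    and n :: nat and a :: real and f :: "real \<Rightarrow> real" and x :: real
  assumes "fractional_derivative S Dom D"
    and "f differentiable_on S"
    and "(\<lambda>x. pochhammer x n * f x) \<in> Dom a"
    and "\<And>u. u \<le> n \<Longrightarrow> falling_factorial a u \<noteq> 0 \<Longrightarrow> f \<in> Dom (a - real u)"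
    and "x \<in> S"
  shows "D a (\<lambda>x. pochhammer x n * f x) x =
    (\<Sum>m=0..n. \<Sum>u=0..m. real (n choose m) * real_of_int (stirling_S1 m u) * pochhammer x (n - m)
       * (-1) ^ (m + u) * falling_factorial a u * D (a - real u) f x)"
proof -
  interpret fractional_derivative S Dom D by fact
  have product: "(\<lambda>x. poly (rising_poly n) x * f x) \<in> Dom a"
    using assms(3) by simp
  \<comment> \<open>\<open>a gchoose m\<close> and \<open>falling_factorial a m\<close> differ by
    the nonzero factor \<open>fact m\<close>, so they vanish together.\<close>
  have terms: "f \<in> Dom (a - real m)" if "m \<le> degree (rising_poly n)" "a gchoose m \<noteq> 0" for m
    using that assms(4)[of m] by (simp add: gbinomial_eq_falling_factorial)
  define c where "c m u = real (n choose m) * ((-1) ^ (m + u) * real_of_int (stirling_S1 m u))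
    * pochhammer x (n - m)" for m u
  \<comment> \<open>The zero factor removes the summands beyond \<open>n\<close>, whatever value
    \<open>D (a - real u) f x\<close> takes there.\<close>
  have vanish: "poly ((pderiv ^^ u) (rising_poly n)) x = 0" if "u \<notin> {..n}" for u
    using that by (simp add: poly_higher_pderiv_eq_coeff_shift coeff_eq_0 degree_pcompose)
  have "D a (\<lambda>x. pochhammer x n * f x) x =
      (\<Sum>u. (a gchoose u) * D (a - real u) f x * poly ((pderiv ^^ u) (rising_poly n)) x)"
    using leibniz[OF product terms \<open>x \<in> S\<close>] by simp
  also have "\<dots> = (\<Sum>u\<le>n. (a gchoose u) * D (a - real u) f x
      * poly ((pderiv ^^ u) (rising_poly n)) x)"
    using vanish by (intro suminf_finite) auto
  \<comment> \<open>The \<open>fact u\<close> of the Taylor formula cancels the denominator of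
    \<open>a gchoose u\<close>.\<close>
  also have "\<dots> = (\<Sum>u\<le>n. \<Sum>m\<le>n.
      if u \<le> m then c m u * falling_factorial a u * D (a - real u) f x else 0)"
    by (intro sum.cong refl)
      (simp add: poly_higher_pderiv_rising_poly gbinomial_eq_falling_factorial c_def
        sum_distrib_left if_distrib mult_ac cong: if_cong)
  \<comment> \<open>The guard \<open>u \<le> m\<close> keeps both ranges equal to
    \<open>{..n}\<close>, so the sums swap without reindexing a triangle; afterwards it cuts the
    inner range to \<open>{..m}\<close>.\<close>
  also have "\<dots> = (\<Sum>m\<le>n. \<Sum>u\<le>n.
      if u \<le> m then c m u * falling_factorial a u * D (a - real u) f x else 0)"
    by (rule sum.swap)
  also have "\<dots> = (\<Sum>m\<le>n. \<Sum>u\<le>m. c m u * falling_factorial a u * D (a - real u) f x)"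
    by (intro sum.cong refl sum.mono_neutral_cong_right) auto
  finally show ?thesis
    by (simp add: c_def atMost_atLeast0 mult_ac)
qed

end
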